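(* Let $K$ be a field, let $H$ be a subgroup of the stable general linear group $\mathrm{GL}_\infty(K)$ with $\mathrm{E}_\infty(K)\leq H\leq \mathrm{GL}_\infty(K)$, and let $T$ be the $H$-class of $[t_{2,1,2}(1)]_\infty$. Let $C$ be a noncentral $H$-class. Then $m(C)=1$ if $C=T$, and $m(C)=2$ if $C\neq T$.
   Context: $\mathrm{GL}_\infty(K)=\varinjlim_n \mathrm{GL}_n(K)$ is the direct limit with respect to the transition homomorphisms $\mathrm{GL}_n(K)\to \mathrm{GL}_{n+k}(K)$, $\sigma\mapsto e_{k\times k}\oplus\sigma$ (block diagonal sum, with the $k\times k$ identity matrix as the upper left block). $[\sigma]_\infty$ denotes the class in $\mathrm{GL}_\infty(K)$ of $\sigma\in\mathrm{GL}_n(K)$. For $n\geq 2$, $1\leq i\neq j\leq n$, $a\in K$, $t_{n,i,j}(a)=e+ae^{ij}\in \mathrm{GL}_n(K)$, where $e$ is the identity matrix and $e^{ij}$ the matrix unit; $\mathrm{E}_\infty(K)$ is the subgroup of $\mathrm{GL}_\infty(K)$ generated by all $[t_{n,i,j}(a)]_\infty$. For $g\in \mathrm{GL}_\infty(K)$, the $H$-class of $g$ is $g^H=\{h^{-1}gh\mid h\in H\}$; it is noncentral if $g$ is not in the center of $\mathrm{GL}_\infty(K)$ (which consists only of the identity). If $C=g^H$, then $C^{1}:=C$ and $C^{-1}:=(g^{-1})^H$. Products of classes are elementwise products of sets. For a noncentral $H$-class $C$, $m(C)$ is the minimal positive integer $m$ such that there exist $i_1,\dots,i_m\in\{\pm1\}$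 with $T\subseteq C^{i_1}\cdots C^{i_m}$. *)

theory Defs
  imports "Jordan_Normal_Form.Matrix" "HOL-Algebra.Generated_Groups"
    "HOL-Library.Extended_Nat"
begin

section \<open>The stable general linear group\<close>

definition GL :: "nat \<Rightarrow> 'a::field mat set" where
  "GL n = {A \<in> carrier_mat n n. invertible_mat A}"

definition stab :: "nat \<Rightarrow> 'a::field mat \<Rightarrow> 'a mat" where
  "stab k A = four_block_mat (1\<^sub>m k) (0\<^sub>m k (dim_col A)) (0\<^sub>m (dim_row A) k) A"

text \<open>
  The direct limit is the disjoint union of the groups \<open>GL n\<close>, \<open>n \<ge> 1\<close>, modulo becoming equal
  at some later stage. Matrices carry their dimensions, so the disjoint union is a plain set of
  matrices, and equality of \<open>stab k A\<close> and \<open>stab l B\<close> includes equality of their dimensions.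
\<close>

definition GL_fin :: "'a::field mat set" where
  "GL_fin = (\<Union>n\<in>{1..}. GL n)"

definition stable_rel :: "'a::field mat rel" where
  "stable_rel = {(A, B). A \<in> GL_fin \<and> B \<in> GL_fin \<and> (\<exists>k l. stab k A = stab l B)}"

definition stable_class :: "'a::field mat \<Rightarrow> 'a mat set" where
  "stable_class A = stable_rel `` {A}"

text \<open>
  The product of two classes is computed on representatives of equal size. All such choices give
  the same class (see \<open>mult_stable_class\<close> below), so the union is that class.
\<close>

definition GL_inf :: "'a::field mat set monoid" where
  "GL_inf = \<lparr>carrier = GL_fin // stable_rel,
             mult = (\<lambda>X Y. \<Union>n\<in>{1..}. \<Union>A\<in>X \<inter> GL n. \<Union>B\<in>Y \<inter> GL n. stable_class (A * B)),
             one = stable_class (1\<^sub>m 1)\<rparr>"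

text \<open>Matrix entries are indexed from 0 in the library; \<open>i\<close> and \<open>j\<close> below range over \<open>1, \<dots>, n\<close>.\<close>

definition matrix_unit :: "nat \<Rightarrow> nat \<Rightarrow> nat \<Rightarrow> 'a::field mat" where
  "matrix_unit n i j = mat n n (\<lambda>(r, c). if r + 1 = i \<and> c + 1 = j then 1 else 0)"

definition transvection :: "nat \<Rightarrow> nat \<Rightarrow> nat \<Rightarrow> 'a::field \<Rightarrow> 'a mat" where
  "transvection n i j a = 1\<^sub>m n + a \<cdot>\<^sub>m matrix_unit n i j"

definition E_inf :: "'a::field mat set set" where
  "E_inf = generate GL_inf
     {stable_class (transvection n i j a) | n i j a.
        2 \<le> n \<and> i \<in> {1..n} \<and> j \<in> {1..n} \<and> i \<noteq> j}"


section \<open>Classes under conjugation by a subgroup\<close>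

definition conj_class :: "('g, 'm) monoid_scheme \<Rightarrow> 'g set \<Rightarrow> 'g \<Rightarrow> 'g set" where
  "conj_class G H g = {inv\<^bsub>G\<^esub> h \<otimes>\<^bsub>G\<^esub> g \<otimes>\<^bsub>G\<^esub> h | h. h \<in> H}"

definition center :: "('g, 'm) monoid_scheme \<Rightarrow> 'g set" where
  "center G = {z \<in> carrier G. \<forall>x\<in>carrier G. z \<otimes>\<^bsub>G\<^esub> x = x \<otimes>\<^bsub>G\<^esub> z}"

definition noncentral_class :: "('g, 'm) monoid_scheme \<Rightarrow> 'g set \<Rightarrow> 'g set \<Rightarrow> bool" where
  "noncentral_class G H C \<longleftrightarrow> (\<exists>g\<in>carrier G. g \<notin> center G \<and> C = conj_class G H g)"

text \<open>
  For \<open>C\<close> the class of \<open>g\<close>, its inverse is the class of the inverse of \<open>g\<close>; this does not depend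
  on the choice of \<open>g\<close> (see \<open>class_inv_conj_class\<close> below).
\<close>

definition class_inv :: "('g, 'm) monoid_scheme \<Rightarrow> 'g set \<Rightarrow> 'g set \<Rightarrow> 'g set" where
  "class_inv G H C =
     (THE D. \<exists>g\<in>carrier G. C = conj_class G H g \<and> D = conj_class G H (inv\<^bsub>G\<^esub> g))"

text \<open>The exponent \<open>i\<close> is only ever \<open>1\<close> or \<open>-1\<close>.\<close>

definition class_pow :: "('g, 'm) monoid_scheme \<Rightarrow> 'g set \<Rightarrow> 'g set \<Rightarrow> int \<Rightarrow> 'g set" where
  "class_pow G H C i = (if i = 1 then C else class_inv G H C)"

definition class_prod :: "('g, 'm) monoid_scheme \<Rightarrow> 'g set \<Rightarrow> 'g set \<Rightarrow> int list \<Rightarrow> 'g set" where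
  "class_prod G H C is = foldr (\<lambda>i P. class_pow G H C i <#>\<^bsub>G\<^esub> P) is {\<one>\<^bsub>G\<^esub>}"

definition T_class :: "'a::field mat set set \<Rightarrow> 'a mat set set" where
  "T_class H = conj_class GL_inf H (stable_class (transvection 2 1 2 1))"

text \<open>The infimum in \<^typ>\<open>enat\<close> is the minimum, or \<open>\<infinity>\<close> if there is no such \<open>m\<close>.\<close>

definition covering_number :: "'a::field mat set set \<Rightarrow> 'a mat set set \<Rightarrow> enat" where
  "covering_number H C =
     (INF m \<in> {m::nat. 0 < m \<and> (\<exists>is. length is = m \<and> set is \<subseteq> {1, -1} \<and>
                                  T_class H \<subseteq> class_prod GL_inf H C is)}. enat m)"


section \<open>Well-definedness\<close>

lemma GL_carrier: "A \<in> GL n \<Longrightarrow> A \<in> carrier_mat n n"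
  by (simp add: GL_def)

lemma GL_iff: "A \<in> GL n \<longleftrightarrow>
    A \<in> carrier_mat n n \<and> (\<exists>B\<in>carrier_mat n n. A * B = 1\<^sub>m n \<and> B * A = 1\<^sub>m n)" (is "_ \<longleftrightarrow> ?R")
proof
  assume "A \<in> GL n"
  then obtain B where A: "A \<in> carrier_mat n n" and B: "A * B = 1\<^sub>m n" "B * A = 1\<^sub>m (dim_row B)"
    by (auto simp: GL_def invertible_mat_def inverts_mat_def)
  have "dim_col B = n" using arg_cong[OF B(1), of dim_col] by simp
  moreover have "dim_row B = n" using arg_cong[OF B(2), of dim_col] A by simp
  ultimately show ?R using A B by (intro conjI bexI[of _ B]) auto
next
  assume ?R
  then obtain B where "A \<in> carrier_mat n n" "B \<in> carrier_mat n n" "A * B = 1\<^sub>m n" "B * A = 1\<^sub>m n"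
    by blast
  then show "A \<in> GL n"
    unfolding GL_def invertible_mat_def inverts_mat_def by (intro CollectI conjI exI[of _ B]) auto
qed

lemma GL_one: "1\<^sub>m n \<in> GL n"
  by (auto simp: GL_iff intro!: bexI[of _ "1\<^sub>m n"])

lemma GL_inverse: "A \<in> GL n \<Longrightarrow> \<exists>B\<in>GL n. A * B = 1\<^sub>m n \<and> B * A = 1\<^sub>m n"
  using GL_iff[of A n] GL_iff[of _ n] GL_carrier[of A n] by metis

lemma GL_mult:
  assumes "A \<in> GL n" "B \<in> GL n"
  shows "A * B \<in> GL n"
proof -
  obtain A' where A: "A \<in> carrier_mat n n" "A' \<in> carrier_mat n n" "A * A' = 1\<^sub>m n" "A' * A = 1\<^sub>m n"
    using assms(1) by (auto simp: GL_iff)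
  obtain B' where B: "B \<in> carrier_mat n n" "B' \<in> carrier_mat n n" "B * B' = 1\<^sub>m n" "B' * B = 1\<^sub>m n"
    using assms(2) by (auto simp: GL_iff)
  note assoc = assoc_mult_mat[of _ n n _ n _ n]
  have "(A * B) * (B' * A') = A * ((B * B') * A')"
    using A(1,2) B(1,2) assoc[of A B "B' * A'"] assoc[of B B' A'] by simp
  moreover have "(B' * A') * (A * B) = B' * ((A' * A) * B)"
    using A(1,2) B(1,2) assoc[of B' A' "A * B"] assoc[of A' A B] by simp
  ultimately show ?thesis
    unfolding GL_iff using A B by (intro conjI bexI[of _ "B' * A'"]) auto
qed

lemma stab_carrier: "A \<in> carrier_mat n n \<Longrightarrow> stab k A \<in> carrier_mat (k + n) (k + n)"
  by (auto simp: stab_def)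

lemma stab_0: "stab 0 A = A"
  by (rule eq_matI) (auto simp: stab_def)

lemma stab_stab: "stab k (stab l A) = stab (k + l) A"
  by (rule eq_matI) (auto simp: stab_def)

lemma stab_one: "stab k (1\<^sub>m n) = 1\<^sub>m (k + n)"
  by (simp add: stab_def)

lemma stab_mult:
  assumes "A \<in> carrier_mat n n" "B \<in> carrier_mat n n"
  shows "stab k (A * B) = stab k A * stab k B"
proof -
  have "stab k A * stab k B =
      four_block_mat (1\<^sub>m k * 1\<^sub>m k + 0\<^sub>m k n * 0\<^sub>m n k) (1\<^sub>m k * 0\<^sub>m k n + 0\<^sub>m k n * B)
        (0\<^sub>m n k * 1\<^sub>m k + A * 0\<^sub>m n k) (0\<^sub>m n k * 0\<^sub>m k n + A * B)"
    using assms by (simp add: stab_def mult_four_block_mat[of _ k k _ n _ n _ _ k _ n])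
  also have "\<dots> = stab k (A * B)"
    using assms by (simp add: stab_def)
  finally show ?thesis by simp
qed

lemma stab_GL: assumes "A \<in> GL n" shows "stab k A \<in> GL (k + n)"
proof -
  obtain B where B: "A \<in> carrier_mat n n" "B \<in> carrier_mat n n" "A * B = 1\<^sub>m n" "B * A = 1\<^sub>m n"
    using assms by (auto simp: GL_iff)
  then show ?thesis
    unfolding GL_iff
    by (intro conjI bexI[of _ "stab k B"]) (auto simp: stab_carrier stab_one simp flip: stab_mult)
qed

lemma GL_fin_I: "A \<in> GL n \<Longrightarrow> 1 \<le> n \<Longrightarrow> A \<in> GL_fin"
  by (auto simp: GL_fin_def)

lemma equiv_stable_rel: "equiv GL_fin (stable_rel :: 'a::field mat rel)"
proof (rule equivI)
  show "(stable_rel :: 'a mat rel) \<subseteq> GL_fin \<times> GL_fin"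
    by (auto simp: stable_rel_def)
  show "refl_on GL_fin (stable_rel :: 'a mat rel)"
    by (auto simp: refl_on_def stable_rel_def)
  show "sym (stable_rel :: 'a mat rel)"
    by (rule symI) (auto simp: stable_rel_def, metis)
  show "trans (stable_rel :: 'a mat rel)"
  proof (rule transI)
    fix A B C :: "'a mat"
    assume "(A, B) \<in> stable_rel" "(B, C) \<in> stable_rel"
    then obtain k l p q where *: "A \<in> GL_fin" "C \<in> GL_fin" "stab k A = stab l B" "stab p B = stab q C"
      by (auto simp: stable_rel_def)
    have "stab (p + k) A = stab (l + q) C"
      using *(3,4) by (metis stab_stab add.commute)
    then show "(A, C) \<in> stable_rel"
      using * by (auto simp: stable_rel_def)
  qed
qed

lemma stable_class_eq:
  "A \<in> GL_fin \<Longrightarrow> B \<in> GL_fin \<Longrightarrow> stab k A = stab l B \<Longrightarrow> stable_class A = stable_class B"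
  unfolding stable_class_def by (rule equiv_class_eq[OF equiv_stable_rel]) (auto simp: stable_rel_def)

lemma stable_class_stab: "A \<in> GL n \<Longrightarrow> 1 \<le> n \<Longrightarrow> stable_class (stab k A) = stable_class A"
  by (rule stable_class_eq[of _ _ 0 k])
    (auto simp: stab_0 intro: GL_fin_I[of _ n] GL_fin_I[of _ "k + n"] stab_GL)

lemma stable_class_self: "A \<in> GL_fin \<Longrightarrow> A \<in> stable_class A"
  by (auto simp: stable_class_def stable_rel_def)

lemma stable_class_closed: "A \<in> GL_fin \<Longrightarrow> stable_class A \<in> carrier GL_inf"
  by (auto simp: GL_inf_def stable_class_def quotient_def)

lemma GL_inf_cases:
  assumes "X \<in> carrier GL_inf"
  obtains n A where "1 \<le> n" "A \<in> GL n" "X = stable_class A"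
  using assms by (auto simp: GL_inf_def stable_class_def quotient_def GL_fin_def)

lemma mult_stable_class:
  assumes n: "1 \<le> n" and A: "A \<in> GL n" and B: "B \<in> GL n"
  shows "stable_class A \<otimes>\<^bsub>GL_inf\<^esub> stable_class B = stable_class (A * B)"
proof -
  have *: "stable_class (A' * B') = stable_class (A * B)"
    if m: "1 \<le> m" and A': "A' \<in> stable_class A" "A' \<in> GL m"
      and B': "B' \<in> stable_class B" "B' \<in> GL m" for m A' B'
  proof -
    obtain k l where kl: "stab k A = stab l A'"
      using A' by (auto simp: stable_class_def stable_rel_def)
    obtain k' l' where kl': "stab k' B = stab l' B'"
      using B' by (auto simp: stable_class_def stable_rel_def)
    note c = GL_carrier[OF A] GL_carrier[OF B] GL_carrier[OF A'(2)] GL_carrier[OF B'(2)]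
    have "k + n = l + m"
      using arg_cong[OF kl, of dim_row] c by (simp add: stab_def)
    moreover have "k' + n = l' + m"
      using arg_cong[OF kl', of dim_row] c by (simp add: stab_def)
    ultimately have eq: "k' + l = k + l'" by linarith
    have "stab (k' + k) A = stab (k' + l) A'"
      using kl by (metis stab_stab)
    moreover have "stab (k' + k) B = stab (k' + l) B'"
      using kl' eq by (metis stab_stab add.commute)
    ultimately have "stab (k' + k) (A * B) = stab (k' + l) (A' * B')"
      using c by (simp add: stab_mult[of _ n] stab_mult[of _ m])
    then show ?thesis
      using GL_fin_I[OF GL_mult[OF A B] n] GL_fin_I[OF GL_mult[OF A'(2) B'(2)] m]
      by (metis stable_class_eq)
  qed
  have "A \<in> stable_class A" "B \<in> stable_class B"
    using GL_fin_I n A B by (blast intro: stable_class_self)+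
  then have mem: "A \<in> stable_class A \<inter> GL n" "B \<in> stable_class B \<inter> GL n"
    using A B by blast+
  have "(\<Union>n\<in>{1..}. \<Union>A'\<in>stable_class A \<inter> GL n. \<Union>B'\<in>stable_class B \<inter> GL n.
      stable_class (A' * B')) = stable_class (A * B)" (is "?L = _")
  proof
    show "?L \<subseteq> stable_class (A * B)"
      using * by (intro UN_least) (metis IntE atLeast_iff order_refl)
    show "stable_class (A * B) \<subseteq> ?L"
      using n mem by (intro subsetI UN_I[of n] UN_I[of A] UN_I[of B]) auto
  qed
  then show ?thesis
    by (simp add: GL_inf_def)
qed

lemma GL_inf_common:
  assumes "X \<in> carrier GL_inf" "Y \<in> carrier GL_inf"
  obtains n A B where "1 \<le> n" "A \<in> GL n" "B \<in> GL n" "X = stable_class A" "Y = stable_class B"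
proof -
  obtain n A where A: "1 \<le> n" "A \<in> GL n" "X = stable_class A"
    using assms(1) by (rule GL_inf_cases)
  obtain m B where B: "1 \<le> m" "B \<in> GL m" "Y = stable_class B"
    using assms(2) by (rule GL_inf_cases)
  show thesis
    using that[of "m + n" "stab m A" "stab n B"] A B stab_GL[OF A(2), of m] stab_GL[OF B(2), of n]
    by (simp add: stable_class_stab add.commute)
qed

lemma one_GL_inf: "1 \<le> n \<Longrightarrow> \<one>\<^bsub>GL_inf\<^esub> = stable_class (1\<^sub>m n :: 'a::field mat)"
  using stable_class_stab[OF GL_one[of 1, where 'a = 'a], of "n - 1"]
  by (simp add: GL_inf_def stab_one)

lemma group_GL_inf: "group (GL_inf :: 'a::field mat set monoid)"
proof (rule groupI)
  fix X Y :: "'a mat set" assume "X \<in> carrier GL_inf" "Y \<in> carrier GL_inf"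
  then obtain n A B where *: "1 \<le> n" "A \<in> GL n" "B \<in> GL n" "X = stable_class A" "Y = stable_class B"
    by (rule GL_inf_common)
  then show "X \<otimes>\<^bsub>GL_inf\<^esub> Y \<in> carrier GL_inf"
    by (simp add: mult_stable_class[of n] stable_class_closed GL_fin_I[of _ n] GL_mult)
next
  show "\<one>\<^bsub>GL_inf\<^esub> \<in> carrier (GL_inf :: 'a mat set monoid)"
    by (simp add: one_GL_inf[of 1] stable_class_closed GL_fin_I[OF GL_one])
next
  fix X Y Z :: "'a mat set"
  assume X: "X \<in> carrier GL_inf" and Y: "Y \<in> carrier GL_inf" and Z: "Z \<in> carrier GL_inf"
  obtain n A B where 1: "1 \<le> n" "A \<in> GL n" "B \<in> GL n" "X = stable_class A" "Y = stable_class B"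
    using X Y by (rule GL_inf_common)
  obtain m C where 2: "1 \<le> m" "C \<in> GL m" "Z = stable_class C"
    using Z by (rule GL_inf_cases)
  define A' B' C' where defs: "A' = stab m A" "B' = stab m B" "C' = stab n C"
  have G: "A' \<in> GL (m + n)" "B' \<in> GL (m + n)" "C' \<in> GL (m + n)"
    unfolding defs using stab_GL[OF 1(2)] stab_GL[OF 1(3)] stab_GL[OF 2(2), of n]
    by (simp_all add: add.commute)
  have eq: "X = stable_class A'" "Y = stable_class B'" "Z = stable_class C'"
    unfolding defs using 1 2 by (simp_all add: stable_class_stab)
  show "X \<otimes>\<^bsub>GL_inf\<^esub> Y \<otimes>\<^bsub>GL_inf\<^esub> Z = X \<otimes>\<^bsub>GL_inf\<^esub> (Y \<otimes>\<^bsub>GL_inf\<^esub> Z)"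
    unfolding eq using G 1(1) G[THEN GL_carrier]
    by (simp add: mult_stable_class[of "m + n"] GL_mult
        assoc_mult_mat[of _ "m + n" "m + n" _ "m + n" _ "m + n"])
next
  fix X :: "'a mat set" assume "X \<in> carrier GL_inf"
  then obtain n A where *: "1 \<le> n" "A \<in> GL n" "X = stable_class A"
    by (rule GL_inf_cases)
  show "\<one>\<^bsub>GL_inf\<^esub> \<otimes>\<^bsub>GL_inf\<^esub> X = X"
    using * GL_carrier[OF *(2)] by (simp add: one_GL_inf[of n] mult_stable_class[of n] GL_one)
  obtain B where "B \<in> GL n" "B * A = 1\<^sub>m n"
    using GL_inverse[OF *(2)] by blast
  then show "\<exists>Y\<in>carrier GL_inf. Y \<otimes>\<^bsub>GL_inf\<^esub> X = \<one>\<^bsub>GL_inf\<^esub>"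
    using * by (intro bexI[of _ "stable_class B"])
      (auto simp: one_GL_inf[of n] mult_stable_class[of n] intro!: stable_class_closed GL_fin_I[of _ n])
qed

lemma transvection_GL:
  fixes a :: "'a::field"
  assumes "i \<noteq> j"
  shows "transvection n i j a \<in> GL n"
proof -
  have N: "matrix_unit n i j * matrix_unit n i j = (0\<^sub>m n n :: 'a mat)"
    using assms by (intro eq_matI) (auto simp: matrix_unit_def scalar_prod_def intro!: sum.neutral)
  have c: "(matrix_unit n i j :: 'a mat) \<in> carrier_mat n n"
    by (simp add: matrix_unit_def)
  have *: "transvection n i j b * transvection n i j d = 1\<^sub>m n" if "b + d = 0" for b d :: 'a
  proof -
    let ?N = "matrix_unit n i j :: 'a mat"
    have "transvection n i j b * transvection n i j d
        = 1\<^sub>m n + d \<cdot>\<^sub>m ?N + (b \<cdot>\<^sub>m ?N + b \<cdot>\<^sub>m (d \<cdot>\<^sub>m (?N * ?N)))"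
      unfolding transvection_def
      using add_mult_distrib_mat[of "1\<^sub>m n" n n "b \<cdot>\<^sub>m ?N" "1\<^sub>m n + d \<cdot>\<^sub>m ?N" n]
        mult_add_distrib_mat[of "b \<cdot>\<^sub>m ?N" n n "1\<^sub>m n" n "d \<cdot>\<^sub>m ?N"]
        mult_smult_assoc_mat[of ?N n n "d \<cdot>\<^sub>m ?N" n b] mult_smult_distrib[of ?N n n ?N n d] c
      by simp
    also have "\<dots> = 1\<^sub>m n + (b + d) \<cdot>\<^sub>m ?N"
      unfolding N using c by (intro eq_matI) (auto simp: algebra_simps)
    also have "\<dots> = 1\<^sub>m n"
      unfolding that using c by (intro eq_matI) auto
    finally show ?thesis .
  qed
  have "transvection n i j b \<in> carrier_mat n n" for b :: 'a
    using c by (simp add: transvection_def)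
  then show ?thesis
    unfolding GL_iff using *[of a "- a"] *[of "- a" a]
    by (intro conjI bexI[of _ "transvection n i j (- a)"]) auto
qed

lemma class_inv_conj_class:
  fixes G (structure)
  assumes "group G" "subgroup H G" "g \<in> carrier G"
  shows "class_inv G H (conj_class G H g) = conj_class G H (inv\<^bsub>G\<^esub> g)"
proof -
  interpret group G by fact
  have H: "h \<in> carrier G" if "h \<in> H" for h
    using that subgroup.subset[OF assms(2)] by blast
  have inv_eq: "conj_class G H (inv x) = (\<lambda>y. inv y) ` conj_class G H x" if x: "x \<in> carrier G" for x
  proof -
    have "inv (inv h \<otimes> x \<otimes> h) = inv h \<otimes> inv x \<otimes> h" if "h \<in> H" for h
      using x H[OF that] by (simp add: inv_mult_group m_assoc)
    then show ?thesis
      unfolding conj_class_def by (auto simp: image_iff) metis+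
  qed
  show ?thesis
    unfolding class_inv_def
    by (rule the_equality) (use assms(3) inv_eq in auto)
qed

end

(*
  Put C = g^H. In a sufficiently large GL n the matrix g has a fixed unit vector u, and for a row
  vector f with f u = 0 the commutator of g with 1 + u f is g^-1 (1 - u f) g (1 + u f) =
  1 + u (f - f g). Since g is not the identity, f can be chosen with f g \<noteq> f, and the commutator
  is a transvection in C^-1 C. Two spare coordinates suffice to conjugate any transvection
  1 + u p by elementary matrices into a fixed one: add the first spare unit vector to u and then
  remove the old u, and do the same to p with the second spare coordinate. Hence all
  transvections lie in T, which gives T \<subseteq> C^-1 C and also T^-1 = T; the latter excludes m(C) = 1
  for C \<noteq> T.
*)

theory Submission
  imports Defs
begin

section \<open>Conjugation by a subgroup\<close>

lemma (in group) inv_mult_cancel_left: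
  assumes "x \<in> carrier G" "y \<in> carrier G"
  shows "inv x \<otimes> (x \<otimes> y) = y" "x \<otimes> (inv x \<otimes> y) = y"
  using assms by (simp_all flip: m_assoc)

text \<open>Since \<open>x\<close> is \<open>h\<close> times \<open>y\<close> times the inverse of
  \<open>h\<close>, conjugating \<open>x\<close> by \<open>k\<close> is conjugating \<open>y\<close>
  by \<open>inv h \<otimes> k\<close>. The hypothesis relating \<open>x\<close> and \<open>y\<close>
  avoids inverses, so for matrices it becomes a plain product identity.\<close>

lemma conj_class_eqI:
  fixes G (structure)
  assumes "group G" "subgroup H G" "x \<in> carrier G" "y \<in> carrier G" "h \<in> H" "x \<otimes> h = h \<otimes> y"
  shows "conj_class G H x = conj_class G H y"
proof -
  interpret group G by fact
  interpret H: subgroup H G by fact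
  have h: "h \<in> carrier G" using assms(5) by auto
  have x_eq: "x = h \<otimes> y \<otimes> inv h"
    using assms(3,4,6) h by (metis inv_solve_right m_closed)
  have "inv k \<otimes> x \<otimes> k = inv (inv h \<otimes> k) \<otimes> y \<otimes> (inv h \<otimes> k)" if "k \<in> H" for k
    unfolding x_eq using that h assms(4) by (simp add: inv_mult_group m_assoc inv_mult_cancel_left)
  moreover have "inv k \<otimes> y \<otimes> k = inv (h \<otimes> k) \<otimes> x \<otimes> (h \<otimes> k)" if "k \<in> H" for k
    unfolding x_eq using that h assms(4) by (simp add: inv_mult_group m_assoc inv_mult_cancel_left)
  ultimately show ?thesis
    unfolding conj_class_def using assms(5) by (blast intro: H.m_closed H.m_inv_closed)
qed

lemma conj_class_self:
  fixes G (structure)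
  assumes "group G" "subgroup H G" "x \<in> carrier G"
  shows "x \<in> conj_class G H x"
proof -
  interpret group G by fact
  show ?thesis
    using assms(3) subgroup.one_closed[OF assms(2)]
    unfolding conj_class_def by (intro CollectI exI[of _ \<one>]) simp
qed

text \<open>Classes are orbits, so sharing the element \<open>x\<close> already forces equality.
  This is what rules out covering numbers equal to 1.\<close>

lemma conj_class_eq_of_subset:
  fixes G (structure)
  assumes "group G" "subgroup H G" "x \<in> carrier G" "y \<in> carrier G"
    and "conj_class G H x \<subseteq> conj_class G H y"
  shows "conj_class G H x = conj_class G H y"
proof -
  interpret group G by fact
  interpret H: subgroup H G by fact
  have "x \<in> conj_class G H y"
    using conj_class_self[OF assms(1-3)] assms(5) by blast
  then obtain h where h: "h \<in> H" "x = inv h \<otimes> y \<otimes> h"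
    by (auto simp: conj_class_def)
  have "y \<otimes> h = h \<otimes> x"
    using h assms(4) H.mem_carrier[OF h(1)] by (simp add: m_assoc inv_mult_cancel_left)
  then show ?thesis
    using conj_class_eqI[OF assms(1,2,4,3) h(1)] by simp
qed

text \<open>The last hypothesis says, without inverses, that \<open>x\<close> is the commutator of
  \<open>g\<close> and \<open>h\<close>, that is, \<open>inv g\<close> times the conjugate of
  \<open>g\<close> by \<open>h\<close>. Conjugation by \<open>k\<close> acts on both factors and
  keeps each in its class.\<close>

lemma conj_class_commutator_subset:
  fixes G (structure)
  assumes "group G" "subgroup H G" "g \<in> carrier G" "h \<in> H" "x \<in> carrier G"
    and "g \<otimes> h = h \<otimes> (g \<otimes> x)"
  shows "conj_class G H x \<subseteq> conj_class G H (inv g) <#> conj_class G H g"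
proof
  interpret group G by fact
  interpret H: subgroup H G by fact
  have h: "h \<in> carrier G" using assms(4) by auto
  have x_eq: "x = inv g \<otimes> (inv h \<otimes> (g \<otimes> h))"
    using assms(3,5,6) h by (simp add: inv_mult_cancel_left)
  fix z assume "z \<in> conj_class G H x"
  then obtain k where k: "k \<in> H" "z = inv k \<otimes> x \<otimes> k"
    by (auto simp: conj_class_def)
  have kc: "k \<in> carrier G" using k(1) by auto
  have "z = (inv k \<otimes> inv g \<otimes> k) \<otimes> (inv (h \<otimes> k) \<otimes> g \<otimes> (h \<otimes> k))"
    unfolding k(2) x_eq using kc h assms(3) by (simp add: m_assoc inv_mult_group inv_mult_cancel_left)
  moreover have "inv k \<otimes> inv g \<otimes> k \<in> conj_class G H (inv g)"
    using k(1) by (auto simp: conj_class_def)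
  moreover have "inv (h \<otimes> k) \<otimes> g \<otimes> (h \<otimes> k) \<in> conj_class G H g"
    using k(1) assms(4) unfolding conj_class_def by blast
  ultimately show "z \<in> conj_class G H (inv g) <#> conj_class G H g"
    by (auto simp: set_mult_def)
qed


section \<open>Transvections\<close>

text \<open>The matrix 1 + u p for a column u and a row p; it is a transvection when p u = 0 and u,
  p are nonzero. Functions on \<open>nat\<close> make shifting and changing coordinates easy; only
  their values below \<open>n\<close> matter.\<close>

definition rank_one_update :: "nat \<Rightarrow> (nat \<Rightarrow> 'a::field) \<Rightarrow> (nat \<Rightarrow> 'a) \<Rightarrow> 'a mat" where
  "rank_one_update n u p = mat n n (\<lambda>(r, c). (if r = c then 1 else 0) + u r * p c)"

abbreviation unit_fun :: "nat \<Rightarrow> nat \<Rightarrow> 'a::field" where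
  "unit_fun i \<equiv> (\<lambda>k. if k = i then 1 else 0)"

lemma sum_unit_fun:
  fixes f :: "nat \<Rightarrow> 'a::field"
  assumes "i < n"
  shows "(\<Sum>k<n. f k * unit_fun i k) = f i" "(\<Sum>k<n. unit_fun i k * f k) = f i"
    "(\<Sum>k<n. f k * unit_fun k i) = f i" "(\<Sum>k<n. unit_fun k i * f k) = f i"
proof -
  have eq: "unit_fun i k = of_bool (k = i)" "unit_fun k i = of_bool (k = i)" for k
    by auto
  show "(\<Sum>k<n. f k * unit_fun i k) = f i" "(\<Sum>k<n. unit_fun i k * f k) = f i"
    "(\<Sum>k<n. f k * unit_fun k i) = f i" "(\<Sum>k<n. unit_fun k i * f k) = f i"
    unfolding eq using assms by simp_all
qed

section \<open>Entries of products with rank one updates\<close>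

lemma rank_one_update_carrier [simp]: "rank_one_update n u p \<in> carrier_mat n n"
  and rank_one_update_dim [simp]:
    "dim_row (rank_one_update n u p) = n" "dim_col (rank_one_update n u p) = n"
  by (simp_all add: rank_one_update_def)

lemma rank_one_update_index:
  "r < n \<Longrightarrow> c < n \<Longrightarrow> rank_one_update n u p $$ (r, c) = (if r = c then 1 else 0) + u r * p c"
  by (simp add: rank_one_update_def)

lemma mult_rank_one_update_index:
  assumes "M \<in> carrier_mat n n" "r < n" "c < n"
  shows "(M * rank_one_update n u p) $$ (r, c) = M $$ (r, c) + (\<Sum>k<n. M $$ (r, k) * u k) * p c"
proof -
  have "(M * rank_one_update n u p) $$ (r, c) =
      (\<Sum>k<n. M $$ (r, k) * (if k = c then 1 else 0) + M $$ (r, k) * u k * p c)"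
    using assms by (auto simp: scalar_prod_def rank_one_update_index atLeast0LessThan algebra_simps
        intro!: sum.cong)
  also have "\<dots> = M $$ (r, c) + (\<Sum>k<n. M $$ (r, k) * u k) * p c"
    using assms(3) by (simp add: sum.distrib sum_distrib_right sum_unit_fun)
  finally show ?thesis .
qed

lemma rank_one_update_mult_index:
  assumes "M \<in> carrier_mat n n" "r < n" "c < n"
  shows "(rank_one_update n u p * M) $$ (r, c) = M $$ (r, c) + u r * (\<Sum>k<n. p k * M $$ (k, c))"
proof -
  have "(rank_one_update n u p * M) $$ (r, c) =
      (\<Sum>k<n. (if r = k then 1 else 0) * M $$ (k, c) + u r * (p k * M $$ (k, c)))"
    using assms by (auto simp: scalar_prod_def rank_one_update_index atLeast0LessThan algebra_simps
        intro!: sum.cong)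
  also have "\<dots> = M $$ (r, c) + u r * (\<Sum>k<n. p k * M $$ (k, c))"
    using assms(2) by (simp add: sum.distrib sum_distrib_left sum_unit_fun)
  finally show ?thesis .
qed

lemma rank_one_update_mult_rank_one_update_index:
  assumes "r < n" "c < n"
  shows "(rank_one_update n u p * rank_one_update n w x) $$ (r, c) =
    (if r = c then 1 else 0) + u r * p c + (w r + u r * (\<Sum>k<n. p k * w k)) * x c"
proof -
  have "(\<Sum>k<n. rank_one_update n u p $$ (r, k) * w k) =
      (\<Sum>k<n. (if r = k then 1 else 0) * w k + u r * (p k * w k))"
    using assms by (intro sum.cong) (auto simp: rank_one_update_index algebra_simps)
  also have "\<dots> = w r + u r * (\<Sum>k<n. p k * w k)"
    using assms(1) by (simp add: sum.distrib sum_distrib_left sum_unit_fun)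
  finally show ?thesis
    using assms
    \<comment> \<open>Without the deletion, product entries would be unfolded into scalar products
      before the closed formula can apply.\<close>
    by (simp add: mult_rank_one_update_index rank_one_update_index del: index_mult_mat(1))
qed

text \<open>If p u = 0, then u p squares to zero, so 1 - u p is the inverse of 1 + u p.\<close>

lemma rank_one_update_GL:
  fixes u p :: "nat \<Rightarrow> 'a::field"
  assumes "(\<Sum>k<n. p k * u k) = 0"
  shows "rank_one_update n u p \<in> GL n"
proof -
  have neg: "(\<Sum>k<n. - (p k * u k)) = 0" using assms by (simp add: sum_negf)
  have "rank_one_update n u p * rank_one_update n u (\<lambda>k. - p k) = 1\<^sub>m n"
    "rank_one_update n u (\<lambda>k. - p k) * rank_one_update n u p = 1\<^sub>m n"
    using assms neg
    by (auto intro!: eq_matI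
      simp: rank_one_update_mult_rank_one_update_index simp del: index_mult_mat(1))
  then show ?thesis
    unfolding GL_iff by (intro conjI bexI[of _ "rank_one_update n u (\<lambda>k. - p k)"]) simp_all
qed

lemma rank_one_update_unit_GL:
  assumes "p i = 0"
  shows "rank_one_update n (unit_fun i) p \<in> GL n"
  using assms by (intro rank_one_update_GL sum.neutral) simp

section \<open>Rank one updates and elementary matrices\<close>

lemma transvection_eq_rank_one_update:
  "transvection n (Suc i) (Suc j) a = rank_one_update n (unit_fun i) (\<lambda>k. if k = j then a else 0)"
  by (rule eq_matI) (auto simp: transvection_def matrix_unit_def rank_one_update_index)

lemma stab_rank_one_update:
  "stab k (rank_one_update n u p) =
    rank_one_update (k + n) (\<lambda>i. if i < k then 0 else u (i - k)) (\<lambda>i. if i < k then 0 else p (i - k))"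
  by (rule eq_matI) (auto simp: stab_def rank_one_update_index)

text \<open>Row \<open>i\<close> is filled one entry at a time, each new entry being contributed by
  one elementary transvection. The conjugating matrices used later have this form and hence lie in
  \<open>H\<close>.\<close>

lemma rank_one_update_unit_in_E_inf:
  fixes p :: "nat \<Rightarrow> 'a::field"
  assumes n: "2 \<le> n" and i: "i < n" and p: "p i = 0"
  shows "stable_class (rank_one_update n (unit_fun i) p) \<in> E_inf"
proof -
  let ?p = "\<lambda>m k. if k < m then p k else 0"
  have "stable_class (rank_one_update n (unit_fun i) (?p m)) \<in> E_inf" if "m \<le> n" for m
    using that
  proof (induction m)
    case 0
    have "rank_one_update n (unit_fun i) (?p 0) = 1\<^sub>m n"
      by (rule eq_matI) (auto simp: rank_one_update_index)
    then show ?case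
      using n generate.one[of GL_inf] by (simp add: E_inf_def one_GL_inf[of n])
  next
    case (Suc m)
    show ?case
    \<comment> \<open>The diagonal position gives no elementary transvection, but there
      \<open>p\<close> vanishes and nothing has to be added.\<close>
    proof (cases "m = i")
      case True
      then have "?p (Suc m) = ?p m" using p by (auto simp: less_Suc_eq)
      then show ?thesis using Suc by simp
    next
      case False
      define q where "q = (\<lambda>k. if k = m then p m else 0)"
      \<comment> \<open>The rows simply add up: the cross term carries the factor
        \<open>?p m i\<close>, which is zero.\<close>
      have "rank_one_update n (unit_fun i) (?p (Suc m)) =
          rank_one_update n (unit_fun i) (?p m) * rank_one_update n (unit_fun i) q"
        using i p by (intro eq_matI)
          (auto simp: rank_one_update_index rank_one_update_mult_rank_one_update_index q_def
            sum_unit_fun less_Suc_eq simp del: index_mult_mat(1))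
      moreover have "rank_one_update n (unit_fun i) (?p m) \<in> GL n"
        "rank_one_update n (unit_fun i) q \<in> GL n"
        using p False by (auto intro!: rank_one_update_unit_GL simp: q_def)
      ultimately have eq: "stable_class (rank_one_update n (unit_fun i) (?p (Suc m))) =
          stable_class (rank_one_update n (unit_fun i) (?p m)) \<otimes>\<^bsub>GL_inf\<^esub>
          stable_class (rank_one_update n (unit_fun i) q)"
        using n by (simp add: mult_stable_class[of n])
      have "stable_class (rank_one_update n (unit_fun i) q) \<in>
          {stable_class (transvection n i j a) | n i j a.
             2 \<le> n \<and> i \<in> {1..n} \<and> j \<in> {1..n} \<and> i \<noteq> j}"
        using n i Suc.prems False transvection_eq_rank_one_update[of n i m "p m"]
        unfolding q_def
        by (intro CollectI exI[of _ n] exI[of _ "Suc i"] exI[of _ "Suc m"] exI[of _ "p m"]) simp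
      then show ?thesis
        unfolding eq using Suc unfolding E_inf_def
        by (intro generate.eng[OF _ generate.incl]) simp_all
    qed
  qed
  from this[of n] have "stable_class (rank_one_update n (unit_fun i) (?p n)) \<in> E_inf" by simp
  moreover have "rank_one_update n (unit_fun i) (?p n) = rank_one_update n (unit_fun i) p"
    by (rule eq_matI) (auto simp: rank_one_update_index)
  ultimately show ?thesis by simp
qed

text \<open>Conjugation by h = 1 + e_i x turns 1 + u p into 1 + (h^-1 u)(p h). The hypotheses say u
  = h u' and p' = p h, so h^-1 never has to be written down.\<close>

lemma conj_class_rank_one_update_eq:
  fixes H :: "'a::field mat set set"
  assumes H: "subgroup H GL_inf" "E_inf \<subseteq> H" and n: "2 \<le> n" and i: "i < n" and x: "x i = 0"
    and u: "\<And>k. k < n \<Longrightarrow> u k = u' k + (\<Sum>l<n. x l * u' l) * unit_fun i k"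
    and p: "\<And>k. k < n \<Longrightarrow> p' k = p k + p i * x k"
    and GL: "(\<Sum>k<n. p k * u k) = 0" "(\<Sum>k<n. p' k * u' k) = 0"
  shows "conj_class GL_inf H (stable_class (rank_one_update n u p)) =
    conj_class GL_inf H (stable_class (rank_one_update n u' p'))"
proof (rule conj_class_eqI[OF group_GL_inf H(1)])
  let ?h = "rank_one_update n (unit_fun i) x"
  have c: "rank_one_update n u p \<in> GL n" "rank_one_update n u' p' \<in> GL n" "?h \<in> GL n"
    using GL x by (auto intro: rank_one_update_GL rank_one_update_unit_GL)
  show "stable_class (rank_one_update n u p) \<in> carrier GL_inf"
    "stable_class (rank_one_update n u' p') \<in> carrier GL_inf"
    using c n by (auto intro!: stable_class_closed GL_fin_I[of _ n])
  show "stable_class ?h \<in> H"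
    using rank_one_update_unit_in_E_inf[OF n i, of x] x H(2) by blast
  have "rank_one_update n u p * ?h = ?h * rank_one_update n u' p'"
  proof (rule eq_matI)
    fix r k assume "r < dim_row (?h * rank_one_update n u' p')"
      "k < dim_col (?h * rank_one_update n u' p')"
    then have "r < n" "k < n" by simp_all
    then show "(rank_one_update n u p * ?h) $$ (r, k) = (?h * rank_one_update n u' p') $$ (r, k)"
      by (simp only: rank_one_update_mult_rank_one_update_index u[of r] p[of k]
          sum_unit_fun[OF i]) (simp add: algebra_simps)
  qed simp_all
  then show "stable_class (rank_one_update n u p) \<otimes>\<^bsub>GL_inf\<^esub> stable_class ?h =
      stable_class ?h \<otimes>\<^bsub>GL_inf\<^esub> stable_class (rank_one_update n u' p')"
    using c n by (simp add: mult_stable_class[of n])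
qed

text \<open>Coordinates 0 and 1 are the spare ones: \<open>p\<close> vanishes there, and
  \<open>a\<close> is neither of them.\<close>

lemma conj_class_transvection_normal_form:
  fixes H :: "'a::field mat set set" and p :: "nat \<Rightarrow> 'a"
  assumes H: "subgroup H GL_inf" "E_inf \<subseteq> H" and a: "2 \<le> a" "a < n"
    and p: "p 0 = 0" "p 1 = 0" "p a = 0" and j: "j < n" "p j \<noteq> 0"
  shows "conj_class GL_inf H (stable_class (rank_one_update n (unit_fun a) p)) =
    conj_class GL_inf H (stable_class (rank_one_update n (unit_fun 0) (unit_fun 1)))"
    (is "?C (unit_fun a) p = _")
proof -
  note step = conj_class_rank_one_update_eq[OF H]
  have n: "2 \<le> n" "0 < n" "Suc 0 < n" using a by auto
  have j01: "j \<noteq> 0" "j \<noteq> 1" using j p by metis+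
  note simps = distrib_left distrib_right sum.distrib sum_negf sum_subtractf sum_unit_fun mult.assoc
    sum_distrib_left[symmetric]
  \<comment> \<open>As \<open>p 0 = 0\<close>, the row is unchanged while e_0 is added to the
    column.\<close>
  have "?C (unit_fun a) p = ?C (\<lambda>k. unit_fun a k + unit_fun 0 k) p"
    using a n p
    by (intro step[where i = 0 and x = "\<lambda>k. - unit_fun a k"]) (auto simp: simps)
  \<comment> \<open>Here \<open>p a = 0\<close> protects the row while e_a is removed from the
    column.\<close>
  also have "\<dots> = ?C (unit_fun 0) p"
    using a n p
    by (intro step[where i = a and x = "unit_fun 0"]) (auto simp: simps)
  \<comment> \<open>The nonzero entry \<open>p j\<close> is scaled to 1 to create the entry at
    coordinate 1; the column e_0 is fixed because the chosen \<open>x\<close> vanishes at 0.\<close>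
  also have "\<dots> = ?C (unit_fun 0) (\<lambda>k. p k + unit_fun 1 k)"
    using a n p j j01
    by (intro step[where i = j and x = "\<lambda>k. inverse (p j) * unit_fun 1 k"])
      (auto simp: simps)
  \<comment> \<open>The row now has entry 1 at coordinate 1, so adding that multiple of
    \<open>- p\<close> cancels the old row; \<open>p 0 = 0\<close> keeps the column.\<close>
  also have "\<dots> = ?C (unit_fun 0) (unit_fun 1)"
    using a n p
    by (intro step[where i = 1 and x = "\<lambda>k. - p k"]) (auto simp: simps)
  finally show ?thesis .
qed

text \<open>The identity block is placed in the upper left, so the 2 by 2 matrix moves to the last
  two coordinates \<open>k\<close> and \<open>Suc k\<close>, counted from 0.\<close>

lemma stab_transvection_2:
  fixes b :: "'a::field"
  shows "stab k (transvection 2 1 2 b) =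
    rank_one_update (k + 2) (unit_fun k) (\<lambda>i. if i = Suc k then b else 0)"
  using transvection_eq_rank_one_update[of 2 0 1 b]
  by (intro eq_matI) (auto simp: numeral_2_eq_2 stab_rank_one_update rank_one_update_index)

text \<open>The bound on \<open>n\<close> leaves coordinates 0 and 1 free after stabilization. The
  scalar \<open>b\<close> disappears in the normal form, which makes \<open>b = 1\<close> and
  \<open>b = -1\<close> conjugate; \<open>n\<close> is left open to match the size of a given
  matrix.\<close>

lemma conj_class_transvection_2:
  fixes H :: "'a::field mat set set"
  assumes H: "subgroup H GL_inf" "E_inf \<subseteq> H" and n: "4 \<le> n" and b: "b \<noteq> 0"
  shows "conj_class GL_inf H (stable_class (transvection 2 1 2 b)) =
    conj_class GL_inf H (stable_class (rank_one_update n (unit_fun 0) (unit_fun 1)))"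
proof -
  define k where "k = n - 2"
  have k: "n = k + 2" "2 \<le> k"
    using n by (simp_all add: k_def)
  have "stable_class (transvection 2 1 2 b) = stable_class (stab k (transvection 2 1 2 b))"
    using stable_class_stab[of "transvection 2 1 2 b" 2 k] transvection_GL[of 1 2 2 b] by simp
  also have "\<dots> = stable_class (rank_one_update n (unit_fun k) (\<lambda>i. if i = Suc k then b else 0))"
    unfolding k(1) stab_transvection_2 ..
  finally show ?thesis
    using conj_class_transvection_normal_form[OF H,
        of k n "\<lambda>i. if i = Suc k then b else 0" "Suc k"] k b
    by simp
qed

section \<open>The class T is closed under inversion\<close>

lemma inv_transvection_2:
  fixes b :: "'a::field"
  shows "inv\<^bsub>GL_inf\<^esub> stable_class (transvection 2 1 2 b) =
    stable_class (transvection 2 1 2 (- b))"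
proof -
  interpret group "GL_inf :: 'a mat set monoid" by (rule group_GL_inf)
  have GL: "transvection 2 1 2 x \<in> GL 2" for x :: 'a
    by (rule transvection_GL) simp
  have eq: "transvection 2 1 2 x = rank_one_update 2 (unit_fun 0) (\<lambda>k. if k = 1 then x else 0)"
    for x :: 'a
    using transvection_eq_rank_one_update[of 2 0 1 x] by (simp add: numeral_2_eq_2)
  have "transvection 2 1 2 (- b) * transvection 2 1 2 b = 1\<^sub>m 2"
    unfolding eq
    by (intro eq_matI)
      (auto simp: rank_one_update_mult_rank_one_update_index sum_unit_fun simp del: index_mult_mat(1))
  then show ?thesis
    using GL[of b] GL[of "- b"]
    by (intro inv_equality)
      (auto simp: mult_stable_class[of 2] one_GL_inf[of 2] intro!: stable_class_closed GL_fin_I[of _ 2])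
qed

lemma class_inv_T_class:
  fixes H :: "'a::field mat set set"
  assumes "subgroup H GL_inf" "E_inf \<subseteq> H"
  shows "class_inv GL_inf H (T_class H) = T_class H"
proof -
  have "stable_class (transvection 2 1 2 (1::'a)) \<in> carrier GL_inf"
    by (intro stable_class_closed GL_fin_I[of _ 2] transvection_GL) simp_all
  then have "class_inv GL_inf H (T_class H) =
      conj_class GL_inf H (stable_class (transvection 2 1 2 (- 1)))"
    unfolding T_class_def inv_transvection_2[symmetric]
    by (rule class_inv_conj_class[OF group_GL_inf assms(1)])
  also have "\<dots> = T_class H"
    unfolding T_class_def using conj_class_transvection_2[OF assms, of 4] by simp
  finally show ?thesis .
qed


section \<open>The covering number\<close>

lemma T_class_subset_class_inv_mult:
  fixes H :: "'a::field mat set set"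
  assumes H: "subgroup H GL_inf" "E_inf \<subseteq> H"
    and g: "g \<in> carrier GL_inf" "g \<noteq> \<one>\<^bsub>GL_inf\<^esub>"
  shows "T_class H \<subseteq>
    conj_class GL_inf H (inv\<^bsub>GL_inf\<^esub> g) <#>\<^bsub>GL_inf\<^esub> conj_class GL_inf H g"
proof -
  obtain n A where A: "1 \<le> n" "A \<in> GL n" "g = stable_class A"
    using g(1) by (rule GL_inf_cases)
  note Ac = GL_carrier[OF A(2)]
  have "A \<noteq> 1\<^sub>m n"
    using g(2) A one_GL_inf[of n] by auto
  \<comment> \<open>Row \<open>i\<close> of \<open>A\<close> differs from that of the identity, so
    the i-th coordinate functional is moved by \<open>A\<close>.\<close>
  then obtain i j where ij: "i < n" "j < n" "A $$ (i, j) \<noteq> (if i = j then 1 else 0)"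
    using Ac by (metis carrier_matD eq_matI index_one_mat)
  \<comment> \<open>Of the three new coordinates, 0 and 1 serve the normal form, and 2 supplies the
    fixed vector u = e_2. Old indices shift by 3.\<close>
  define N where "N = 3 + n"
  define B where "B = stab 3 A"
  have B: "B \<in> GL N" "g = stable_class B"
    unfolding B_def N_def using A stab_GL[OF A(2)] by (simp_all add: stable_class_stab)
  note Bc = GL_carrier[OF B(1)]
  have B_index: "B $$ (r, c) =
      (if r < 3 \<or> c < 3 then if r = c then 1 else 0 else A $$ (r - 3, c - 3))"
    if "r < N" "c < N" for r c
    using that Ac by (auto simp: B_def N_def stab_def)
  let ?f = "unit_fun (i + 3) :: nat \<Rightarrow> 'a"
  \<comment> \<open>This is the row f - f B; it vanishes on the three new coordinates and is nonzero
    at \<open>j + 3\<close>.\<close>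
  define p where "p = (\<lambda>c. ?f c - B $$ (i + 3, c))"
  have p: "p 0 = 0" "p 1 = 0" "p 2 = 0" "p (j + 3) \<noteq> 0"
    using ij B_index by (auto simp: p_def N_def)
  let ?h = "rank_one_update N (unit_fun 2) ?f" and ?x = "rank_one_update N (unit_fun 2) p"
  have GL: "?h \<in> GL N" "?x \<in> GL N"
    using p by (auto intro!: rank_one_update_unit_GL)
  have N: "2 < N" "1 \<le> N" "2 \<le> N" "i + 3 < N" "j + 3 < N" "4 \<le> N"
    using ij A(1) by (auto simp: N_def)
  \<comment> \<open>By B u = u and f u = 0, both sides equal B + u f: on the right, u p + u f B
    collapses to u f.\<close>
  have "B * ?h = ?h * (B * ?x)"
  proof (rule eq_matI)
    \<comment> \<open>Column 2 of \<open>B\<close> is e_2, so right multiplication only adds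
      \<open>q\<close> to row 2; left multiplication by \<open>?h\<close> adds row
      \<open>i + 3\<close> to row 2.\<close>
    have Bx: "(B * rank_one_update N (unit_fun 2) q) $$ (r, c) =
        B $$ (r, c) + (if r = 2 then 1 else 0) * q c" if "r < N" "c < N" for r c q
      unfolding mult_rank_one_update_index[OF Bc that] sum_unit_fun[OF N(1)]
      using that N B_index[of r 2] by simp
    have hM: "(?h * M) $$ (r, c) = M $$ (r, c) + (if r = 2 then 1 else 0) * M $$ (i + 3, c)"
      if "r < N" "c < N" "M \<in> carrier_mat N N" for r c M
      unfolding rank_one_update_mult_index[OF that(3,1,2)] sum_unit_fun[OF N(4)] by simp
    fix r c assume "r < dim_row (?h * (B * ?x))" "c < dim_col (?h * (B * ?x))"
    then have rc: "r < N" "c < N" by simp_all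
    have "B * ?x \<in> carrier_mat N N" using Bc by simp
    then show "(B * ?h) $$ (r, c) = (?h * (B * ?x)) $$ (r, c)"
      using rc N(4) by (simp only: Bx hM) (simp add: p_def)
  qed (use Bc in simp_all)
  then have "g \<otimes>\<^bsub>GL_inf\<^esub> stable_class ?h =
      stable_class ?h \<otimes>\<^bsub>GL_inf\<^esub> (g \<otimes>\<^bsub>GL_inf\<^esub> stable_class ?x)"
    unfolding B(2) using B(1) GL N by (simp add: mult_stable_class[of N] GL_mult)
  moreover have "stable_class ?h \<in> H"
    using rank_one_update_unit_in_E_inf[of N 2 ?f] N H(2) by auto
  moreover have "stable_class ?x \<in> carrier GL_inf"
    using GL N by (auto intro!: stable_class_closed GL_fin_I[of _ N])
  ultimately have "conj_class GL_inf H (stable_class ?x) \<subseteq>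
      conj_class GL_inf H (inv\<^bsub>GL_inf\<^esub> g) <#>\<^bsub>GL_inf\<^esub> conj_class GL_inf H g"
    by (intro conj_class_commutator_subset[OF group_GL_inf H(1) g(1)])
  moreover have "conj_class GL_inf H (stable_class ?x) = T_class H"
    unfolding T_class_def
    using conj_class_transvection_normal_form[OF H, of 2 N p "j + 3"] p N
      conj_class_transvection_2[OF H, of N 1] by simp
  ultimately show ?thesis by simp
qed

text \<open>The given list bounds the infimum from above, and excluding shorter lists bounds it from
  below; \<open>js \<noteq> []\<close> reflects that lengths are positive.\<close>

lemma covering_number_eqI:
  assumes "0 < m" "length is = m" "set is \<subseteq> {1, -1}" "T_class H \<subseteq> class_prod GL_inf H C is"
    and "\<And>js. set js \<subseteq> {1, -1} \<Longrightarrow> js \<noteq> [] \<Longrightarrow> length js < m \<Longrightarrow>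
      \<not> T_class H \<subseteq> class_prod GL_inf H C js"
  shows "covering_number H C = enat m"
  unfolding covering_number_def
proof (rule antisym)
  show "(INF m\<in>{m. 0 < m \<and> (\<exists>is. length is = m \<and> set is \<subseteq> {1, - 1} \<and>
      T_class H \<subseteq> class_prod GL_inf H C is)}. enat m) \<le> enat m"
    using assms(1-4) by (intro INF_lower) blast
  show "enat m \<le> (INF m\<in>{m. 0 < m \<and> (\<exists>is. length is = m \<and> set is \<subseteq> {1, - 1} \<and>
      T_class H \<subseteq> class_prod GL_inf H C is)}. enat m)"
    using assms(5) by (intro INF_greatest) (auto simp: not_less[symmetric])
qed

theorem theorem40:
  fixes H C :: "'a::field mat set set"
  assumes "subgroup H GL_inf" and "E_inf \<subseteq> H"
    and "noncentral_class GL_inf H C"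
  shows "(C = T_class H \<longrightarrow> covering_number H C = 1) \<and>
         (C \<noteq> T_class H \<longrightarrow> covering_number H C = 2)"
proof -
  note H = assms(1,2)
  interpret group "GL_inf :: 'a mat set monoid" by (rule group_GL_inf)
  interpret H: subgroup H "GL_inf :: 'a mat set monoid" by (rule H(1))
  obtain g where g: "g \<in> carrier GL_inf" "g \<notin> center GL_inf" "C = conj_class GL_inf H g"
    using assms(3) by (auto simp: noncentral_class_def)
  have g1: "g \<noteq> \<one>\<^bsub>GL_inf\<^esub>"
    using g(2) by (auto simp: center_def)
  have t: "stable_class (transvection 2 1 2 (1::'a)) \<in> carrier GL_inf"
    by (intro stable_class_closed GL_fin_I[of _ 2] transvection_GL) simp_all
  have inv_C: "class_inv GL_inf H C = conj_class GL_inf H (inv\<^bsub>GL_inf\<^esub> g)"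
    unfolding g(3) by (rule class_inv_conj_class[OF group_GL_inf H(1) g(1)])
  have carrier: "conj_class GL_inf H x \<subseteq> carrier GL_inf" if "x \<in> carrier GL_inf" for x
    using that by (auto simp: conj_class_def)
  \<comment> \<open>Removes the trailing factor with which the fold in \<open>class_prod\<close>
    ends.\<close>
  have mult_one: "S <#>\<^bsub>GL_inf\<^esub> {\<one>\<^bsub>GL_inf\<^esub>} = S" if "S \<subseteq> carrier GL_inf" for S :: "'a mat set set"
    using that by (force simp: set_mult_def)
  have prod1: "class_prod GL_inf H C [1] = C"
    "class_prod GL_inf H C [-1] = class_inv GL_inf H C"
    "class_prod GL_inf H C [-1, 1] = class_inv GL_inf H C <#>\<^bsub>GL_inf\<^esub> C"
    using g(1) carrier by (simp_all add: class_prod_def class_pow_def mult_one inv_C)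
      (simp_all add: g(3) mult_one)
  have "covering_number H C = enat 1" if "C = T_class H"
    using that prod1(1) by (intro covering_number_eqI[of _ "[1]"]) auto
  moreover have "covering_number H C = enat 2" if ne: "C \<noteq> T_class H"
  proof (rule covering_number_eqI[of _ "[-1, 1]"])
    show "T_class H \<subseteq> class_prod GL_inf H C [-1, 1]"
      unfolding prod1(3) inv_C unfolding g(3) by (rule T_class_subset_class_inv_mult[OF H g(1) g1])
    have not_subset: "\<not> T_class H \<subseteq> C"
      using conj_class_eq_of_subset[OF group_GL_inf H(1) t g(1)] ne
      unfolding T_class_def g(3) by blast
    have "\<not> T_class H \<subseteq> class_inv GL_inf H C"
    proof
      assume "T_class H \<subseteq> class_inv GL_inf H C"
      then have "T_class H = conj_class GL_inf H (inv\<^bsub>GL_inf\<^esub> g)"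
        using conj_class_eq_of_subset[OF group_GL_inf H(1) t] g(1)
        unfolding T_class_def inv_C by simp
      \<comment> \<open>Inverting both sides gives back the class of \<open>g\<close>, while T is
        its own inverse class, so C would equal T.\<close>
      then have "class_inv GL_inf H (T_class H) = C"
        using class_inv_conj_class[OF group_GL_inf H(1), of "inv\<^bsub>GL_inf\<^esub> g"] g(1,3) by simp
      then show False
        using class_inv_T_class[OF H] ne by simp
    qed
    \<comment> \<open>Only the lists \<open>[1]\<close> and \<open>[-1]\<close> remain, that is, C
      itself and its inverse class.\<close>
    then show "\<not> T_class H \<subseteq> class_prod GL_inf H C js"
      if "set js \<subseteq> {1, -1}" "js \<noteq> []" "length js < 2" for js
      using that not_subset prod1(1,2) by (cases js) auto
  qed simp_all
  ultimately show ?thesis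
    by (simp add: one_enat_def numeral_eq_enat)
qed

end
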